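(* Let $K$ be a field of characteristic $0$, let $V$ be a $K$-vector space of finite dimension $n\ge 2$, and let $B:V\times V\to K$ be a non-degenerate symmetric bilinear form. Let $B'$ be an arbitrary non-degenerate symmetric bilinear form on $V$. If $B'=B_\phi$ for some $\phi\in\mathrm{End}_K(V)$, then the following holds for any $w\in V\setminus\{0\}$ and any $z_1,z_2\in\{w\}_B^\perp$: $$B'(w,w)=B(w,w)\big(\mathrm{wt}(\phi)_{B,w}^2+B(w,w)B(b,b)\big),$$ $$B'(w,z_1)=B(w,w)\big(\mathrm{wt}(\phi)_{B,w}B(a,z_1)+B(b,\phi_0(z_1))\big),$$ $$B'(z_1,z_2)=B(\phi_0(z_1),\phi_0(z_2))+B(a,z_1)B(a,z_2)B(w,w).$$ Here $a,b\in\{w\}_B^\perp$ and $\phi_0\in E^{(0)}(B,w)$ of weight $0$ are those occurring in the decomposition $$\phi=\phi_0+\frac{\mathrm{wt}(\phi)_{B,w}}{B(w,w)}\phi_{B,w,w}+\phi_{B,w,a}+\phi_{B,b,w}.$$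
   Context: Write $\{w\}_B^\perp=\{u\in V : B(u,w)=0\}$ and $$E^{(0)}(B,w)=\{\phi\in\mathrm{End}_K(V) : B(u,\phi(w))=B(w,\phi(u))=0 \text{ for all } u\in\{w\}_B^\perp\}.$$ The weight of an endomorphism $\phi$ is $\mathrm{wt}(\phi)_{B,w}=B(w,\phi(w))/B(w,w)$. For $u,v\in V$, $\phi_{B,u,v}\in\mathrm{End}_K(V)$ is defined by $\phi_{B,u,v}(x)=B(v,x)u$. For $\phi\in\mathrm{End}_K(V)$, $B_\phi(x,y)=B(\phi(x),\phi(y))$. *)

theory Defs
  imports Complex_Main
begin

text \<open>
  Throughout, the type \<open>'v\<close> with scalar multiplication \<open>scale\<close> is the vector space \<open>V\<close> over the
  field \<open>'k\<close>.
\<close>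

definition bilinear_form :: "('k::field \<Rightarrow> 'v::ab_group_add \<Rightarrow> 'v) \<Rightarrow> ('v \<Rightarrow> 'v \<Rightarrow> 'k) \<Rightarrow> bool" where
  "bilinear_form scale B \<longleftrightarrow>
     (\<forall>x. Vector_Spaces.linear scale (*) (\<lambda>y. B x y)) \<and>
     (\<forall>y. Vector_Spaces.linear scale (*) (\<lambda>x. B x y))"

definition symmetric_form :: "('v \<Rightarrow> 'v \<Rightarrow> 'k) \<Rightarrow> bool" where
  "symmetric_form B \<longleftrightarrow> (\<forall>x y. B x y = B y x)"

definition nondegenerate_form :: "('v::zero \<Rightarrow> 'v \<Rightarrow> 'k::zero) \<Rightarrow> bool" where
  "nondegenerate_form B \<longleftrightarrow>
     (\<forall>x. (\<forall>y. B x y = 0) \<longrightarrow> x = 0) \<and> (\<forall>y. (\<forall>x. B x y = 0) \<longrightarrow> y = 0)"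

definition End :: "('k::field \<Rightarrow> 'v::ab_group_add \<Rightarrow> 'v) \<Rightarrow> ('v \<Rightarrow> 'v) set" where
  "End scale = {\<phi>. Vector_Spaces.linear scale scale \<phi>}"

definition perp :: "('v \<Rightarrow> 'v \<Rightarrow> 'k::zero) \<Rightarrow> 'v \<Rightarrow> 'v set" where
  "perp B w = {u. B u w = 0}"

definition E0 :: "('k::field \<Rightarrow> 'v::ab_group_add \<Rightarrow> 'v) \<Rightarrow> ('v \<Rightarrow> 'v \<Rightarrow> 'k) \<Rightarrow> 'v \<Rightarrow> ('v \<Rightarrow> 'v) set" where
  "E0 scale B w = {\<phi> \<in> End scale. \<forall>u \<in> perp B w. B u (\<phi> w) = 0 \<and> B w (\<phi> u) = 0}"

text \<open>
  For isotropic \<open>w\<close> the weight is \<open>0\<close> by the convention \<open>x / 0 = 0\<close>.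
\<close>

definition wt :: "('v \<Rightarrow> 'v \<Rightarrow> 'k::field) \<Rightarrow> 'v \<Rightarrow> ('v \<Rightarrow> 'v) \<Rightarrow> 'k" where
  "wt B w \<phi> = B w (\<phi> w) / B w w"

definition rank_one :: "('k \<Rightarrow> 'v \<Rightarrow> 'v) \<Rightarrow> ('v \<Rightarrow> 'v \<Rightarrow> 'k) \<Rightarrow> 'v \<Rightarrow> 'v \<Rightarrow> 'v \<Rightarrow> 'v" where
  "rank_one scale B u v = (\<lambda>x. scale (B v x) u)"

definition pullback_form :: "('v \<Rightarrow> 'v \<Rightarrow> 'k) \<Rightarrow> ('v \<Rightarrow> 'v) \<Rightarrow> 'v \<Rightarrow> 'v \<Rightarrow> 'k" where
  "pullback_form B \<phi> = (\<lambda>x y. B (\<phi> x) (\<phi> y))"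

definition weight_decomposition ::
  "('k::field \<Rightarrow> 'v::ab_group_add \<Rightarrow> 'v) \<Rightarrow> ('v \<Rightarrow> 'v \<Rightarrow> 'k) \<Rightarrow> 'v \<Rightarrow> ('v \<Rightarrow> 'v) \<Rightarrow>
   ('v \<Rightarrow> 'v) \<Rightarrow> 'v \<Rightarrow> 'v \<Rightarrow> bool" where
  "weight_decomposition scale B w \<phi> \<phi>\<^sub>0 a b \<longleftrightarrow>
     \<phi>\<^sub>0 \<in> E0 scale B w \<and> wt B w \<phi>\<^sub>0 = 0 \<and> a \<in> perp B w \<and> b \<in> perp B w \<and>
     (\<forall>x. \<phi> x = \<phi>\<^sub>0 x + scale (wt B w \<phi> / B w w) (rank_one scale B w w x)
                + rank_one scale B w a x + rank_one scale B b w x)"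

lemma riesz:
  assumes fd: "finite_dimensional_vector_space scale Basis"
    and bil: "bilinear_form scale B" and nd: "nondegenerate_form B"
    and l: "Vector_Spaces.linear scale (*) l"
  shows "\<exists>a. \<forall>x. B a x = l x"
proof -
  interpret V: finite_dimensional_vector_space scale Basis by (fact fd)
  interpret L: Vector_Spaces.linear scale "(*)" l by (fact l)
  have R: "Vector_Spaces.linear scale (*) (\<lambda>y. B x y)" for x
    using bil by (simp add: bilinear_form_def)
  have Ladd: "B (x + x') y = B x y + B x' y" for x x' y
    using bil unfolding bilinear_form_def Vector_Spaces.linear_iff by blast
  have Lscale: "B (scale c x) y = c * B x y" for c x y
    using bil unfolding bilinear_form_def Vector_Spaces.linear_iff by blast
  define T where "T = (\<lambda>v. \<Sum>b\<in>Basis. scale (B v b) b)"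
  interpret T: Vector_Spaces.linear scale scale T
    unfolding Vector_Spaces.linear_iff T_def
    by (auto intro: V.vector_space_axioms
        simp: Ladd Lscale V.scale_left_distrib sum.distrib V.scale_sum_right)
  have ext: "f = g" if "Vector_Spaces.linear scale (*) f" "Vector_Spaces.linear scale (*) g"
    "\<And>b. b \<in> Basis \<Longrightarrow> f b = g b" for f g
  proof
    fix x
    interpret P: vector_space_pair scale "(*)"
      using that(1) unfolding Vector_Spaces.linear_iff vector_space_pair_def by blast
    show "f x = g x"
      by (rule P.linear_eq_on[OF that(1,2)]) (use V.span_Basis that(3) in auto)
  qed
  have "inj T"
    unfolding T.inj_iff_eq_0
  proof (intro allI impI)
    fix v assume "T v = 0"
    then have "B v b = 0" if "b \<in> Basis" for b
      using V.independent_Basis V.finite_Basis that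
      unfolding T_def V.dependent_finite[OF V.finite_Basis] by blast
    then have "B v = (\<lambda>_. 0)"
      by (intro ext R) (use l in \<open>auto simp: Vector_Spaces.linear_iff\<close>)
    then show "v = 0" using nd unfolding nondegenerate_form_def by metis
  qed
  then have "surj T" by (rule V.linear_inj_imp_surj[OF T.linear_axioms])
  then obtain a where a: "T a = (\<Sum>b\<in>Basis. scale (l b) b)" by (metis surjD)
  have "B a b = l b" if "b \<in> Basis" for b
  proof -
    have "(\<Sum>b\<in>Basis. scale (B a b - l b) b) = 0"
      using a by (simp add: T_def V.scale_left_diff_distrib sum_subtractf)
    then show ?thesis
      using V.independent_Basis that
      unfolding V.dependent_finite[OF V.finite_Basis] by (metis eq_iff_diff_eq_0)
  qed
  then have "B a = l" by (intro ext R l)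
  then show ?thesis by auto
qed

text \<open>
  For anisotropic \<open>w\<close> the decomposition exists and is unique, so the predicate above determines
  \<open>\<phi>\<^sub>0\<close>, \<open>a\<close> and \<open>b\<close>.
\<close>

lemma weight_decomposition_ex1:
  assumes fd: "finite_dimensional_vector_space scale Basis"
    and bil: "bilinear_form scale B" and sym: "symmetric_form B" and nd: "nondegenerate_form B"
    and phi: "\<phi> \<in> End scale" and w: "B w w \<noteq> 0"
  shows "\<exists>!(\<phi>\<^sub>0, a, b). weight_decomposition scale B w \<phi> \<phi>\<^sub>0 a b"
proof -
  interpret V: finite_dimensional_vector_space scale Basis by (fact fd)
  interpret phi: Vector_Spaces.linear scale scale \<phi> using phi by (simp add: End_def)
  have Radd: "B x (y + y') = B x y + B x y'" and Rscale: "B x (scale c y) = c * B x y" for c x y y'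
    using bil unfolding bilinear_form_def Vector_Spaces.linear_iff by blast+
  have comm: "B x y = B y x" for x y using sym by (simp add: symmetric_form_def)
  have Ladd: "B (y + y') x = B y x + B y' x" and Lscale: "B (scale c y) x = c * B y x" for c x y y'
    by (metis comm Radd, metis comm Rscale)
  have Rdiff: "B x (y - y') = B x y - B x y'" for x y y'
    by (metis Radd add_diff_cancel_right' diff_add_cancel)
  have Ldiff: "B (y - y') x = B y x - B y' x" for x y y'
    by (metis comm Rdiff)
  note bl = Radd Rscale Ladd Lscale Rdiff Ldiff
  let ?q = "B w w" and ?t = "wt B w \<phi>"
  have vs: "vector_space ((*) :: 'a \<Rightarrow> _)"
    using bil unfolding bilinear_form_def Vector_Spaces.linear_iff by blast
  obtain a' where a': "\<And>x. B a' x = B w (\<phi> x)"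
    using riesz[OF fd bil nd, of "\<lambda>x. B w (\<phi> x)"]
    by (auto simp: Vector_Spaces.linear_iff phi.add phi.scale Radd Rscale V.vector_space_axioms vs)
  define a where "a = scale (1 / ?q) a' - scale (?t / ?q) w"
  define b where "b = scale (1 / ?q) (\<phi> w) - scale (?t / ?q) w"
  define \<phi>\<^sub>0 where "\<phi>\<^sub>0 = (\<lambda>x. \<phi> x - scale (?t / ?q) (rank_one scale B w w x)
     - rank_one scale B w a x - rank_one scale B b w x)"
  have t: "B w (\<phi> w) = ?t * ?q" using w by (simp add: wt_def)
  have a: "B a w = 0" using w t by (simp add: a_def bl a')
  have b: "B b w = 0" "B w b = 0" using w t comm[of "\<phi> w" w] by (simp_all add: b_def bl)
  have p0w: "\<phi>\<^sub>0 w = 0"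
    using w a by (simp add: \<phi>\<^sub>0_def rank_one_def b_def V.scale_right_diff_distrib)
  interpret P: vector_space_pair scale scale by unfold_locales
  have rank_one_lin: "Vector_Spaces.linear scale scale (rank_one scale B u v)" for u v
    by (simp add: Vector_Spaces.linear_iff rank_one_def V.vector_space_axioms Radd Rscale
        V.scale_left_distrib)
  have p0lin: "\<phi>\<^sub>0 \<in> End scale"
    unfolding End_def \<phi>\<^sub>0_def mem_Collect_eq
    by (intro P.linear_compose_sub P.linear_compose_scale_right rank_one_lin phi.linear_axioms)
  have p0u: "B w (\<phi>\<^sub>0 u) = 0" if "B u w = 0" for u
    using that w b comm[of u w] a' by (simp add: \<phi>\<^sub>0_def rank_one_def bl a_def)
  have B0: "B u 0 = 0" for u using Rscale[of u 0 0] by simp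
  have dec: "weight_decomposition scale B w \<phi> \<phi>\<^sub>0 a b"
    unfolding weight_decomposition_def E0_def
    using p0w p0lin p0u a b by (simp add: perp_def wt_def B0 \<phi>\<^sub>0_def)
  have uniq: "f = \<phi>\<^sub>0 \<and> c = a \<and> d = b" if "weight_decomposition scale B w \<phi> f c d" for f c d
  proof -
    note D = that[unfolded weight_decomposition_def]
    have fE: "f \<in> E0 scale B w" and fw0: "wt B w f = 0" and c: "B c w = 0" and d: "B d w = 0"
      using D by (auto simp: perp_def)
    have f: "\<phi> x = f x + scale (?t / ?q) (scale (B w x) w) + scale (B c x) w + scale (B w x) d" for x
      using D by (simp add: rank_one_def)
    have fw: "f w = 0"
    proof -
      have 1: "B w (f w) = 0" using fw0 w by (simp add: wt_def)
      have 2: "B u (f w) = 0" if "B u w = 0" for u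
        using fE that by (simp add: E0_def perp_def)
      have "B u (f w) = 0" for u
        using 2[of "u - scale (B u w / ?q) w"] 1 w by (simp add: bl)
      then show ?thesis using nd unfolding nondegenerate_form_def by blast
    qed
    have db: "d = b"
    proof -
      have "\<phi> w = scale ?t w + scale ?q d" using f[of w] fw c w by simp
      then show ?thesis using w by (simp add: b_def V.scale_right_distrib)
    qed
    have ca: "c = a"
    proof -
      have perp0: "B c u = B a u" if "B u w = 0" for u
      proof -
        have "B w u = 0" using that comm[of u w] by simp
        moreover have "B w (f u) = 0" using fE that by (simp add: E0_def perp_def)
        ultimately have "B w (\<phi> u) = B c u * ?q" using f[of u] by (simp add: bl)
        then show ?thesis using w \<open>B w u = 0\<close> by (simp add: a_def bl a')
      qed
      have "B c u = B a u" for u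
        using perp0[of "u - scale (B u w / ?q) w"] a c w by (simp add: bl)
      then have "\<forall>u. B (c - a) u = 0" by (simp add: bl)
      then show ?thesis using nd unfolding nondegenerate_form_def by (metis eq_iff_diff_eq_0)
    qed
    have "f = \<phi>\<^sub>0"
    proof
      fix x show "f x = \<phi>\<^sub>0 x"
        using f[of x] db ca by (simp add: \<phi>\<^sub>0_def rank_one_def)
    qed
    then show ?thesis using ca db by blast
  qed
  show ?thesis
  proof (rule ex1I[of _ "(\<phi>\<^sub>0, a, b)"])
    show "case (\<phi>\<^sub>0, a, b) of (\<phi>\<^sub>0, a, b) \<Rightarrow> weight_decomposition scale B w \<phi> \<phi>\<^sub>0 a b"
      unfolding prod.case by (fact dec)
  next
    fix p :: "('b \<Rightarrow> 'b) \<times> 'b \<times> 'b"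
    assume p: "case p of (\<phi>\<^sub>0, a, b) \<Rightarrow> weight_decomposition scale B w \<phi> \<phi>\<^sub>0 a b"
    obtain f c d where fcd: "p = (f, c, d)" by (rule prod_cases3)
    show "p = (\<phi>\<^sub>0, a, b)"
      using uniq[OF p[unfolded fcd prod.case]] fcd by blast
  qed
qed

end

theory Submission
  imports Defs
begin

text \<open>
  Write \<open>q = B(w, w)\<close> and \<open>t = wt(\<phi>)\<close>. The three identities come from expanding \<open>B(\<phi> x, \<phi> y)\<close> once
  \<open>\<phi> w\<close> and \<open>\<phi> z\<close>, for \<open>z\<close> orthogonal to \<open>w\<close>, are put in the simple form
  \<open>\<phi> w = (c + t) w + q b\<close> and \<open>\<phi> z = \<phi>\<^sub>0 z + B(a, z) w\<close>.

  The scalar \<open>c\<close> is there because \<open>\<phi>\<^sub>0 w\<close> is orthogonal to everything in the orthogonal complement of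
  \<open>w\<close>, so that \<open>\<phi>\<^sub>0 w = c w\<close> by non-degeneracy (lemma \<open>double_perp_vector\<close>). For anisotropic \<open>w\<close>
  the vanishing weight of \<open>\<phi>\<^sub>0\<close> forces \<open>c = 0\<close>. For isotropic \<open>w\<close> the scalar \<open>c\<close> can be nonzero, but
  in the expansion every \<open>c\<close> is multiplied by \<open>q\<close> or by \<open>B(w, \<phi>\<^sub>0 z) = 0\<close>. Both cases are therefore
  covered by \<open>c q = 0\<close>, and one computation serves for all \<open>w \<noteq> 0\<close>.
\<close>

lemma bilinear_form_add_scale:
  assumes "bilinear_form scale B"
  shows "B (x + x') y = B x y + B x' y" "B x (y + y') = B x y + B x y'"
    and "B (scale c x) y = c * B x y" "B x (scale c y) = c * B x y"
  using assms unfolding bilinear_form_def Vector_Spaces.linear_iff by blast+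

lemma bilinear_form_diff:
  assumes "bilinear_form scale B"
  shows "B (x - x') y = B x y - B x' y" "B x (y - y') = B x y - B x y'"
  by (metis bilinear_form_add_scale(1)[OF assms] add_diff_cancel_right' diff_add_cancel)
    (metis bilinear_form_add_scale(2)[OF assms] add_diff_cancel_right' diff_add_cancel)

text \<open>
  If \<open>B(v, w) = 1\<close>, then \<open>u - B(u, w) v\<close> is orthogonal to \<open>w\<close> for every \<open>u\<close>, hence also to \<open>y\<close>. This
  gives \<open>B(u, y) = B(u, w) B(v, y)\<close> for all \<open>u\<close>, so \<open>y = B(v, y) w\<close>. Subtracting
  a multiple of \<open>v\<close> instead of \<open>w\<close> makes the argument work when \<open>w\<close> is isotropic and lies in
  its own complement.
\<close>

lemma double_perp_vector:
  assumes bil: "bilinear_form scale B" and nd: "nondegenerate_form B"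
    and w: "w \<noteq> 0" and y: "\<And>u. u \<in> perp B w \<Longrightarrow> B u y = 0"
  obtains c where "y = scale c w"
proof -
  note bl = bilinear_form_add_scale[OF bil] bilinear_form_diff[OF bil]
  obtain v' where v': "B v' w \<noteq> 0"
    using nd w unfolding nondegenerate_form_def by blast
  define v where "v = scale (1 / B v' w) v'"
  have v: "B v w = 1" using v' by (simp add: v_def bl)
  have "B u (y - scale (B v y) w) = 0" for u
    using y[of "u - scale (B u w) v"] v by (simp add: perp_def bl mult.commute)
  then have "y - scale (B v y) w = 0"
    using nd unfolding nondegenerate_form_def by blast
  then show thesis using that by simp
qed

lemma E0_weight_0_eigenvector:
  assumes bil: "bilinear_form scale B" and nd: "nondegenerate_form B"
    and w: "w \<noteq> 0" and E: "\<phi>\<^sub>0 \<in> E0 scale B w" and wt: "wt B w \<phi>\<^sub>0 = 0"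
  obtains c where "\<phi>\<^sub>0 w = scale c w" and "c * B w w = 0"
proof -
  obtain c where c: "\<phi>\<^sub>0 w = scale c w"
    using double_perp_vector[OF bil nd w, of "\<phi>\<^sub>0 w"] E unfolding E0_def by blast
  then have "c * B w w = 0"
    using wt by (auto simp: wt_def bilinear_form_add_scale[OF bil])
  with c show thesis using that by blast
qed

theorem theorem3p2:
  fixes scale :: "'k::field_char_0 \<Rightarrow> 'v::ab_group_add \<Rightarrow> 'v"
    and Basis :: "'v set"
    and B B' :: "'v \<Rightarrow> 'v \<Rightarrow> 'k"
    and \<phi> \<phi>\<^sub>0 :: "'v \<Rightarrow> 'v"
    and w z\<^sub>1 z\<^sub>2 a b :: 'v
  assumes "finite_dimensional_vector_space scale Basis"
    and "vector_space.dim scale (UNIV :: 'v set) \<ge> 2"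
    and "bilinear_form scale B" and "symmetric_form B" and "nondegenerate_form B"
    and "bilinear_form scale B'" and "symmetric_form B'" and "nondegenerate_form B'"
    and "\<phi> \<in> End scale" and "B' = pullback_form B \<phi>"
    and "w \<noteq> 0" and "z\<^sub>1 \<in> perp B w" and "z\<^sub>2 \<in> perp B w"
    and "weight_decomposition scale B w \<phi> \<phi>\<^sub>0 a b"
  shows "B' w w = B w w * ((wt B w \<phi>)\<^sup>2 + B w w * B b b) \<and>
         B' w z\<^sub>1 = B w w * (wt B w \<phi> * B a z\<^sub>1 + B b (\<phi>\<^sub>0 z\<^sub>1)) \<and>
         B' z\<^sub>1 z\<^sub>2 = B (\<phi>\<^sub>0 z\<^sub>1) (\<phi>\<^sub>0 z\<^sub>2) + B a z\<^sub>1 * B a z\<^sub>2 * B w w"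
proof -
  note bil = \<open>bilinear_form scale B\<close>
  note bl = bilinear_form_add_scale[OF bil]
  interpret V: finite_dimensional_vector_space scale Basis by fact
  let ?q = "B w w" and ?t = "wt B w \<phi>"
  have comm: "B x y = B y x" for x y
    using \<open>symmetric_form B\<close> by (simp add: symmetric_form_def)
  have E: "\<phi>\<^sub>0 \<in> E0 scale B w" and wt0: "wt B w \<phi>\<^sub>0 = 0" and aw: "B a w = 0" and bw: "B b w = 0"
    and dec: "\<phi> x = \<phi>\<^sub>0 x + scale (?t / ?q) (scale (B w x) w) + scale (B a x) w + scale (B w x) b"
    for x
    using \<open>weight_decomposition scale B w \<phi> \<phi>\<^sub>0 a b\<close>
    by (auto simp: weight_decomposition_def perp_def rank_one_def)
  obtain c where c: "\<phi>\<^sub>0 w = scale c w" and cq: "c * ?q = 0"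
    using E0_weight_0_eigenvector[OF bil \<open>nondegenerate_form B\<close> \<open>w \<noteq> 0\<close> E wt0] .
  (* For isotropic w both sides are 0: the weight is itself a quotient by q, and x / 0 = 0. *)
  have "?t / ?q * ?q = ?t" by (simp add: wt_def)
  then have phi_w: "\<phi> w = scale (c + ?t) w + scale ?q b"
    using dec[of w] c aw by (simp add: V.scale_left_distrib)
  have phi_z: "\<phi> z = \<phi>\<^sub>0 z + scale (B a z) w" and w_phi0_z: "B w (\<phi>\<^sub>0 z) = 0"
    if "z \<in> perp B w" for z
    using that dec[of z] comm[of w z] E by (auto simp: perp_def E0_def)
  have wb: "B w b = 0" using bw comm by simp
  have sq: "(c + ?t) * ?q = ?t * ?q" using cq by (simp add: distrib_right)
  have "B (\<phi> w) (\<phi> w) = (c + ?t) * ((c + ?t) * ?q) + ?q * (?q * B b b)"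
    unfolding phi_w by (simp add: bl wb bw)
  also have "\<dots> = ?t * ((c + ?t) * ?q) + ?q * (?q * B b b)"
    by (subst sq) (metis mult.left_commute sq)
  finally have ww: "B (\<phi> w) (\<phi> w) = ?q * (?t\<^sup>2 + ?q * B b b)"
    unfolding sq by (simp add: algebra_simps power2_eq_square)
  have "B (\<phi> w) (\<phi> z\<^sub>1) = B a z\<^sub>1 * ((c + ?t) * ?q) + ?q * B b (\<phi>\<^sub>0 z\<^sub>1)"
    unfolding phi_w phi_z[OF \<open>z\<^sub>1 \<in> perp B w\<close>]
    by (simp add: bl bw w_phi0_z[OF \<open>z\<^sub>1 \<in> perp B w\<close>] algebra_simps)
  then have wz: "B (\<phi> w) (\<phi> z\<^sub>1) = ?q * (?t * B a z\<^sub>1 + B b (\<phi>\<^sub>0 z\<^sub>1))"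
    unfolding sq by (simp add: algebra_simps)
  have "B (\<phi>\<^sub>0 z\<^sub>1) w = 0" using w_phi0_z[OF \<open>z\<^sub>1 \<in> perp B w\<close>] comm by simp
  then have zz: "B (\<phi> z\<^sub>1) (\<phi> z\<^sub>2) = B (\<phi>\<^sub>0 z\<^sub>1) (\<phi>\<^sub>0 z\<^sub>2) + B a z\<^sub>1 * B a z\<^sub>2 * ?q"
    unfolding phi_z[OF \<open>z\<^sub>1 \<in> perp B w\<close>] phi_z[OF \<open>z\<^sub>2 \<in> perp B w\<close>]
    by (simp add: bl w_phi0_z[OF \<open>z\<^sub>2 \<in> perp B w\<close>])
  show ?thesis
    using ww wz zz by (simp add: \<open>B' = pullback_form B \<phi>\<close> pullback_form_def)
qed

end
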